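(* Let \[I(z,0)=\sum_{n\geq 0}|\mathcal P^{-1}(\mathrm{Av}_n(231))\cap\overline{\mathsf D}\mathsf{FBPT}|\,z^n=\sum_{k\geq 0}|\mathcal W_2(2k+1)\cap\mathrm{ALT}|\,z^{2k+1}\] be the generating function that counts (standardized) $2$-stack-sortable alternating permutations of odd length. Then $\mathcal R(I(z,0),z)=0$, where \[\mathcal R(v,z)=(-z + 27 z^3) + (1 - 33 z^2) v + (4 z + 33 z^3) v^2 + (6 z^2 + z^4) v^3 + 4 z^3 v^4 + z^4 v^5.\]
   Context: $S_n$ is the set of permutations of $\{1,\dots,n\}$ in one-line notation. $\mathrm{Av}_n(231)$ is the set of $\pi\in S_n$ with no indices $i_1<i_2<i_3$ such that $\pi_{i_3}<\pi_{i_1}<\pi_{i_2}$. West's stack-sorting map $s$ is defined recursively: $s$ of the empty permutation is empty, and if $\pi=LmR$ with $m$ the largest entry of $\pi$, then $s(\pi)=s(L)\,s(R)\,m$. $\mathcal W_2(n)$ is the set of $2$-stack-sortable permutations in $S_n$, i.e. those $\pi\in S_n$ with $s(s(\pi))$ increasing. A permutation $\pi$ of length $n$ is alternating if its descents (indices $i\in\{1,\dots,n-1\}$ with $\pi_i>\pi_{i+1}$) are precisely the even elements of $\{1,\dots,n-1\}$; $\mathrm{ALT}$ is the set of alternating permutations. A binary plane tree is a finite rooted tree in which every vertex has at most two children, every child is designated as either a left child or a right child (not both), and no vertex has two left or two right children; it is full if it is nonempty and every vertex has $0$ or $2$ children. $\overline{\mathsf D}\mathsf{FBPT}$ is the set of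 full binary plane trees with vertices bijectively labeled by $1,\dots,m$ ($m$ the number of vertices) so that every nonroot vertex has a smaller label than its parent. The postorder reading is $\mathcal P(\mathcal T)=\mathcal P(\mathcal T_L)\,\mathcal P(\mathcal T_R)\,m$, where $m$ is the root label and $\mathcal T_L,\mathcal T_R$ are the left and right subtrees of the root (the empty tree has empty reading); $\mathcal P^{-1}(A)$ is the set of trees whose postorder reading lies in $A$. *)

theory Defs
  imports
    "HOL-Library.Tree"
    "HOL-Combinatorics.Multiset_Permutations"
    "HOL-Computational_Algebra.Formal_Power_Series"
begin

(* A permutation of {1..n} is the list of its values in one-line notation; the entry written
   \<pi>_i on paper is  \<pi> ! (i - 1),  since lists are indexed from 0. *)
definition perms :: "nat \<Rightarrow> nat list set" where
  "perms n = permutations_of_set {1..n}"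

definition Av231 :: "nat \<Rightarrow> nat list set" where
  "Av231 n = {\<pi> \<in> perms n. \<not> (\<exists>i\<^sub>1 i\<^sub>2 i\<^sub>3. i\<^sub>1 < i\<^sub>2 \<and> i\<^sub>2 < i\<^sub>3 \<and> i\<^sub>3 < length \<pi> \<and>
                              \<pi> ! i\<^sub>3 < \<pi> ! i\<^sub>1 \<and> \<pi> ! i\<^sub>1 < \<pi> ! i\<^sub>2)}"

(* West's map. The list is cut at the first occurrence of its maximum m; lemma stack_sort_LmR
   below is the recursion in the form s(L m R) = s(L) s(R) m. *)
function stack_sort :: "nat list \<Rightarrow> nat list" where
  "stack_sort [] = []"
| "stack_sort (x # xs) =
     stack_sort (takeWhile (\<lambda>y. y \<noteq> Max (set (x # xs))) (x # xs)) @
     stack_sort (tl (dropWhile (\<lambda>y. y \<noteq> Max (set (x # xs))) (x # xs))) @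
     [Max (set (x # xs))]"
  by pat_completeness auto
termination
proof (relation "measure length")
  fix x :: nat and xs :: "nat list"
  define p where "p = x # xs"
  define m where "m = Max (set p)"
  have "m \<in> set p" unfolding m_def p_def by (rule Max_in) auto
  then obtain L R where p: "p = L @ m # R" "m \<notin> set L"
    by (metis split_list_first)
  have "takeWhile (\<lambda>y. y \<noteq> m) p = L" "dropWhile (\<lambda>y. y \<noteq> m) p = m # R"
    unfolding p(1) using p(2) by (auto simp: takeWhile_append dropWhile_append)
  then have "length (takeWhile (\<lambda>y. y \<noteq> m) p) < length p"
    and "length (tl (dropWhile (\<lambda>y. y \<noteq> m) p)) < length p"
    unfolding \<open>takeWhile _ _ = _\<close> \<open>dropWhile _ _ = _\<close> by (simp_all add: p(1))
  then show "(takeWhile (\<lambda>y. y \<noteq> Max (set (x # xs))) (x # xs), x # xs) \<in> measure length"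
    and "(tl (dropWhile (\<lambda>y. y \<noteq> Max (set (x # xs))) (x # xs)), x # xs) \<in> measure length"
    unfolding m_def p_def by (simp_all only: in_measure)
qed (rule wf_measure)

lemma stack_sort_LmR:
  assumes "\<forall>y \<in> set L \<union> set R. y < m"
  shows "stack_sort (L @ m # R) = stack_sort L @ stack_sort R @ [m]"
proof -
  have max: "Max (set (L @ m # R)) = m"
    using assms by (intro Max_eqI) (auto intro: less_imp_le)
  have tw: "takeWhile (\<lambda>y. y \<noteq> m) (L @ m # R) = L"
    using assms by (auto simp: takeWhile_append)
  have dw: "dropWhile (\<lambda>y. y \<noteq> m) (L @ m # R) = m # R"
    using assms by (auto simp: dropWhile_append)
  obtain x xs where eq: "L @ m # R = x # xs"
    by (cases L) auto
  show ?thesis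
    using stack_sort.simps(2)[of x xs] unfolding eq[symmetric] max tw dw by (simp only: list.sel)
qed

definition W2 :: "nat \<Rightarrow> nat list set" where
  "W2 n = {\<pi> \<in> perms n. sorted_wrt (<) (stack_sort (stack_sort \<pi>))}"

definition descents :: "nat list \<Rightarrow> nat set" where
  "descents \<pi> = {i \<in> {1..<length \<pi>}. \<pi> ! (i - 1) > \<pi> ! i}"

definition ALT :: "nat list set" where
  "ALT = (\<Union>n. {\<pi> \<in> perms n. descents \<pi> = {i \<in> {1..<n}. even i}})"

(* A labeled binary plane tree is a  nat tree  whose vertices are the Node constructors; an absent
   left or right child, like the empty tree, is a Leaf, and size counts the vertices. *)
definition full_tree :: "'a tree \<Rightarrow> bool" where
  "full_tree t \<longleftrightarrow> t \<noteq> Leaf \<and> (\<forall>l a r. Node l a r \<in> subtrees t \<longrightarrow> (l = Leaf \<longleftrightarrow> r = Leaf))"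

definition decreasing_tree :: "nat tree \<Rightarrow> bool" where
  "decreasing_tree t \<longleftrightarrow> (\<forall>l a r. Node l a r \<in> subtrees t \<longrightarrow>
     (\<forall>c \<in> {l, r}. c \<noteq> Leaf \<longrightarrow> value c < a))"

(* The first condition says that the labeling is a bijection onto {1..size t}: the postorder
   reading lists the label of every vertex exactly once. *)
definition DFBPT :: "nat tree set" where
  "DFBPT = {t. postorder t \<in> perms (size t) \<and> decreasing_tree t \<and> full_tree t}"

(* I(z,0), with z = fps_X; its equality with alt_gf is not built in. *)
definition tree_gf :: "int fps" where
  "tree_gf = Abs_fps (\<lambda>n. int (card ((postorder -` Av231 n) \<inter> DFBPT)))"

definition alt_gf :: "int fps" where
  "alt_gf = Abs_fps (\<lambda>n. if odd n then int (card (W2 n \<inter> ALT)) else 0)"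

definition RR :: "'a::comm_ring_1 \<Rightarrow> 'a \<Rightarrow> 'a" where
  "RR v z = (- z + 27 * z ^ 3) + (1 - 33 * z ^ 2) * v + (4 * z + 33 * z ^ 3) * v ^ 2
            + (6 * z ^ 2 + z ^ 4) * v ^ 3 + 4 * z ^ 3 * v ^ 4 + z ^ 4 * v ^ 5"

end

theory Submission
  imports Defs "HOL-Computational_Algebra.Polynomial"
begin

text \<open>
  \<^bold>\<open>The two counts.\<close> Every word with distinct entries is the in-order reading of exactly one decreasing
  binary tree (\<open>ex_decreasing_tree\<close>, \<open>inorder_inject\<close>). The tree is full exactly if the word is
  alternating of odd length (\<open>full_tree_iff_alternating\<close>), and West's map sends the in-order reading to
  the postorder reading (\<open>stack_sort_inorder\<close>). As a word with distinct entries is sorted by one pass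
  exactly if it avoids 231, the in-order reading is a bijection between the objects counted by the two
  series (\<open>bij_betw_inorder\<close>).

  \<^bold>\<open>The functional equation.\<close> Call a place in a word a cut if everything to its left is smaller than
  everything to its right, and let \<open>F(u)\<close> be the series of the trees in \<open>z\<close>, with \<open>u\<close> marking the cuts
  of the postorder reading. When the root is removed, avoidance of 231 says that the labels of the left
  subtree, apart from the largest one \<open>a\<close>, are smaller than those of the right subtree, and that \<open>a\<close> is
  inserted into the values of the right subtree at one of its cuts (\<open>bij_betw_joins\<close>). The cuts of the
  whole tree are then determined (\<open>cuts_join\<close>), and
  \<open>(u - 1) F(u) = z u\<^sup>2 (u - 1) + z u F(u) (F(u) - F(1))\<close> follows (\<open>cut_gf_equation\<close>).

  \<^bold>\<open>Elimination of \<open>u\<close>.\<close> This is a quadratic equation \<open>P(F(u), u) = 0\<close>. Let \<open>G\<close> be the derivative of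
  \<open>P\<close> in its first argument, taken at \<open>F(u)\<close>. Differentiating the equation with respect to \<open>u\<close> shows
  that \<open>G\<close> also divides the other partial derivative. So modulo \<open>G\<close> there are three equations, from
  which \<open>F(u)\<close> and then \<open>u\<close> can be eliminated: \<open>G\<close> divides \<open>RR(F(1), z)\<close> up to harmless factors
  (\<open>kernel_elimination\<close>). But the lowest coefficient of \<open>G\<close> is \<open>1 - u\<close>, which cannot divide a nonzero
  constant, so \<open>RR(F(1), z) = 0\<close> (\<open>const_multiple_vanishes\<close>).
\<close>

unbundle fps_syntax

section \<open>Words avoiding 231\<close>

text \<open>
  An entry placed in front of \<open>w\<close> is the 2 of no 231 pattern exactly if it splits \<open>w\<close>; this gives
  \<open>avoids_231\<close> below a recursion on lists.
\<close>

definition splits :: "'a::linorder \<Rightarrow> 'a list \<Rightarrow> bool" where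
  "splits x w = sorted_wrt (\<lambda>y z. \<not> (z < x \<and> x < y)) w"

primrec avoids_231 :: "'a::linorder list \<Rightarrow> bool" where
  "avoids_231 [] = True"
| "avoids_231 (x # w) = (splits x w \<and> avoids_231 w)"

lemma avoids_231_iff_nth:
  "avoids_231 w \<longleftrightarrow>
    (\<nexists>i j k. i < j \<and> j < k \<and> k < length w \<and> w ! k < w ! i \<and> w ! i < w ! j)"
proof (induction w)
  case (Cons x w)
  have "(\<exists>i j k. i < j \<and> j < k \<and> k < length (x # w) \<and> (x # w) ! k < (x # w) ! i \<and> (x # w) ! i < (x # w) ! j)
    \<longleftrightarrow> (\<exists>j k. j < k \<and> k < length w \<and> w ! k < x \<and> x < w ! j) \<or>
        (\<exists>i j k. i < j \<and> j < k \<and> k < length w \<and> w ! k < w ! i \<and> w ! i < w ! j)" (is "?L \<longleftrightarrow> ?A \<or> ?B")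
  proof
    assume ?L
    then obtain i j k where *: "i < j" "j < k" "k < length (x # w)"
      "(x # w) ! k < (x # w) ! i" "(x # w) ! i < (x # w) ! j" by blast
    from * obtain j' where j': "j = Suc j'" by (cases j) auto
    from * obtain k' where k': "k = Suc k'" by (cases k) auto
    show "?A \<or> ?B"
    proof (cases i)
      case 0
      then show ?thesis using * j' k' by auto
    next
      case (Suc i')
      then have "i' < j' \<and> j' < k' \<and> k' < length w \<and> w ! k' < w ! i' \<and> w ! i' < w ! j'"
        using * j' k' by auto
      then show ?thesis by blast
    qed
  next
    assume "?A \<or> ?B"
    then show ?L
    proof
      assume ?A
      then obtain j k where "j < k \<and> k < length w \<and> w ! k < x \<and> x < w ! j" by blast
      then show ?L
        by (intro exI [of _ 0] exI [of _ "Suc j"] exI [of _ "Suc k"]) auto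
    next
      assume ?B
      then obtain i j k where "i < j \<and> j < k \<and> k < length w \<and> w ! k < w ! i \<and> w ! i < w ! j"
        by blast
      then show ?L
        by (intro exI [of _ "Suc i"] exI [of _ "Suc j"] exI [of _ "Suc k"]) auto
    qed
  qed
  moreover have "splits x w \<longleftrightarrow> \<not> ?A"
    by (auto simp: splits_def sorted_wrt_iff_nth_less)
  ultimately show ?case using Cons.IH by auto
qed simp

lemma Av231_eq: "Av231 n = {w \<in> perms n. avoids_231 w}"
  by (simp add: Av231_def avoids_231_iff_nth)

lemma in_perms_iff: "w \<in> perms n \<longleftrightarrow> set w = {1..n} \<and> distinct w"
  by (auto simp: perms_def permutations_of_set_def)

lemma splits_append:
  "splits x (A @ B) \<longleftrightarrow> splits x A \<and> splits x B \<and> (\<forall>y\<in>set A. \<forall>z\<in>set B. \<not> (z < x \<and> x < y))"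
  by (simp add: splits_def sorted_wrt_append)

lemma splits_Nil [simp]: "splits x []"
  and splits_Cons: "splits x (y # w) \<longleftrightarrow> (\<forall>z\<in>set w. \<not> (z < x \<and> x < y)) \<and> splits x w"
  by (simp_all add: splits_def)

lemma splits_if_le: "(\<And>y. y \<in> set w \<Longrightarrow> y \<le> x) \<Longrightarrow> splits x w"
  by (induction w) (auto simp: splits_Cons not_less)

lemma splits_if_ge: "(\<And>y. y \<in> set w \<Longrightarrow> x \<le> y) \<Longrightarrow> splits x w"
  by (induction w) (auto simp: splits_Cons not_less)

text \<open>
  The last two conditions exclude the patterns that use letters of both words: those with only the 2
  in \<open>A\<close>, and those with only the 1 in \<open>B\<close>.
\<close>

lemma avoids_231_append:
  "avoids_231 (A @ B) \<longleftrightarrow> avoids_231 A \<and> avoids_231 B \<and> (\<forall>x\<in>set A. splits x B) \<and>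
     sorted_wrt (\<lambda>x y. \<forall>z\<in>set B. \<not> (z < x \<and> x < y)) A"
  by (induction A) (auto simp: splits_append)

lemma avoids_231_snoc_max:
  assumes "\<And>y. y \<in> set w \<Longrightarrow> y < a"
  shows "avoids_231 (w @ [a]) \<longleftrightarrow> avoids_231 w"
  using assms by (induction w) (auto simp: splits_append splits_Cons not_less less_imp_le)

lemma splits_map:
  assumes "strict_mono_on V f" "set w \<subseteq> V" "x \<in> V"
  shows "splits (f x) (map f w) \<longleftrightarrow> splits x w"
proof -
  have "f (w ! i) < f x \<longleftrightarrow> w ! i < x" "f x < f (w ! i) \<longleftrightarrow> x < w ! i" if "i < length w" for i
    using strict_mono_on_less [OF assms(1)] assms(2,3) nth_mem [OF that] by blast+
  then show ?thesis by (auto simp: splits_def sorted_wrt_iff_nth_less)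
qed

lemma avoids_231_map:
  assumes "strict_mono_on V f" "set w \<subseteq> V"
  shows "avoids_231 (map f w) \<longleftrightarrow> avoids_231 w"
  using assms(2) by (induction w) (auto simp: splits_map [OF assms(1)])

section \<open>Cuts of a word\<close>

text \<open>
  The cuts of a permutation are the places, both ends included, between its direct-sum components.
  Their number is the statistic that makes the tree decomposition recursive. The definition compares
  letters only, so it does not depend on the set of labels.
\<close>

definition cuts :: "'a::linorder list \<Rightarrow> nat set" where
  "cuts w = {k \<in> {..length w}. \<forall>x\<in>set (take k w). \<forall>y\<in>set (drop k w). x < y}"

lemma finite_cuts [simp]: "finite (cuts w)"
  by (simp add: cuts_def)

lemma cuts_map:
  assumes "strict_mono_on V f" "set w \<subseteq> V"
  shows "cuts (map f w) = cuts w"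
proof -
  have "f x < f y \<longleftrightarrow> x < y" if "x \<in> set (take k w)" "y \<in> set (drop k w)" for x y k
    using strict_mono_on_less [OF assms(1)] assms(2) in_set_takeD [OF that(1)] in_set_dropD [OF that(2)]
    by blast
  then show ?thesis by (simp add: cuts_def take_map drop_map)
qed

lemma splits_imp_take_drop:
  assumes "splits x w" "x \<notin> set w" and k: "k = length (filter (\<lambda>y. y < x) w)"
  shows "(\<forall>y\<in>set (take k w). y < x) \<and> (\<forall>y\<in>set (drop k w). x < y)"
  using assms
proof (induction w arbitrary: k)
  case (Cons y w)
  show ?case
  proof (cases "y < x")
    case True
    have "splits x w" "x \<notin> set w" using Cons.prems by (auto simp: splits_Cons)
    note IH = Cons.IH [OF this refl]
    have k: "k = Suc (length (filter (\<lambda>y. y < x) w))" unfolding Cons.prems(3) using True by simp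
    show ?thesis unfolding k take_Suc_Cons drop_Suc_Cons using IH True by (metis set_ConsD)
  next
    case False
    then have "filter (\<lambda>y. y < x) w = []"
      using Cons.prems by (auto simp: splits_Cons filter_empty_conv)
    then have "k = 0" "\<forall>z\<in>set (y # w). \<not> z < x"
      unfolding Cons.prems(3) using False by (simp_all add: filter_empty_conv)
    then show ?thesis using Cons.prems(2) by (metis drop0 empty_iff empty_set linorder_neqE take0)
  qed
qed simp

lemma cut_imp_splits:
  assumes "k \<in> cuts w" "x \<notin> set w" and k: "k = length (filter (\<lambda>y. y < x) w)"
  shows "splits x w"
proof -
  have eq: "length (filter (\<lambda>y. y < x) (take k w)) + length (filter (\<lambda>y. y < x) (drop k w)) = k"
    using k by (metis append_take_drop_id filter_append length_append)
  have len: "length (take k w) = k" using assms(1) by (auto simp: cuts_def)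
  have cut: "\<forall>a\<in>set (take k w). \<forall>b\<in>set (drop k w). a < b" using assms(1) by (auto simp: cuts_def)
  have "(\<forall>y\<in>set (take k w). y < x) \<and> (\<forall>y\<in>set (drop k w). x < y)"
  proof (cases "\<exists>y\<in>set (take k w). \<not> y < x")
    case True
    then obtain y where y: "y \<in> set (take k w)" "\<not> y < x" by blast
    then have "filter (\<lambda>y. y < x) (drop k w) = []"
      using cut by (force simp: filter_empty_conv)
    then have "length (filter (\<lambda>y. y < x) (take k w)) = length (take k w)" using eq len by simp
    then have "\<forall>y\<in>set (take k w). y < x" by (metis filter_id_conv length_filter_less nat_less_le)
    then show ?thesis using y by blast
  next
    case False
    then have "filter (\<lambda>y. y < x) (take k w) = take k w" by (auto simp: filter_id_conv)
    then have "filter (\<lambda>y. y < x) (drop k w) = []" using eq len by simp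
    then have "\<forall>y\<in>set (drop k w). \<not> y < x" by (auto simp: filter_empty_conv)
    then have "\<forall>y\<in>set (drop k w). x < y" using assms(2) set_drop_subset [of k w] by (metis linorder_neqE subsetD)
    then show ?thesis using False by blast
  qed
  then have "splits x (take k w @ drop k w)"
    unfolding splits_append using splits_if_le [of "take k w" x] splits_if_ge [of "drop k w" x]
    by (meson less_asym less_imp_le)
  then show ?thesis by simp
qed

text \<open>
  If \<open>x\<close> splits \<open>w\<close>, the letters below \<open>x\<close> form a prefix, and a prefix of smaller letters ends at a
  cut. Conversely, a cut prefix with as many letters as there are letters below \<open>x\<close> consists of
  precisely these letters, because a cut prefix always contains the smallest letters.
\<close>

lemma splits_iff_cut:
  assumes "x \<notin> set w" "distinct w"
  shows "splits x w \<longleftrightarrow> card {y \<in> set w. y < x} \<in> cuts w"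
proof -
  have k: "card {y \<in> set w. y < x} = length (filter (\<lambda>y. y < x) w)"
    using assms(2) by (metis distinct_card distinct_filter set_filter)
  have "length (filter (\<lambda>y. y < x) w) \<in> cuts w" if "splits x w"
  proof -
    let ?k = "length (filter (\<lambda>y. y < x) w)"
    have "y < z" if "y \<in> set (take ?k w)" "z \<in> set (drop ?k w)" for y z
      using splits_imp_take_drop [OF \<open>splits x w\<close> assms(1) refl] that less_trans by blast
    then show ?thesis
      unfolding cuts_def using length_filter_le [of "\<lambda>y. y < x" w] by blast
  qed
  then show ?thesis
    using cut_imp_splits [OF _ assms(1) refl] unfolding k by blast
qed

text \<open>
  A cut of the long word lies inside \<open>A' @ [a]\<close>, where it is a cut of that word other than its right
  end; or between two letters of \<open>B\<close> or at an end of \<open>B\<close>, where it must not leave a letter smaller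
  than \<open>a\<close> to its right; or at the very end. The excluded right end of \<open>A' @ [a]\<close> and the new cut
  after \<open>n\<close> balance in the count.
\<close>

lemma cuts_join:
  fixes A' B :: "'a::linorder list"
  assumes A': "\<And>x. x \<in> set A' \<Longrightarrow> x < a" and A'B: "\<And>x y. x \<in> set A' \<Longrightarrow> y \<in> set B \<Longrightarrow> x < y"
    and k: "k \<le> length B" "\<And>y. y \<in> set (take k B) \<Longrightarrow> y < a" "\<And>y. y \<in> set (drop k B) \<Longrightarrow> a < y"
    and n: "a < n" "\<And>y. y \<in> set B \<Longrightarrow> y < n"
  shows "card (cuts (A' @ [a] @ B @ [n])) = card (cuts (A' @ [a])) + card {j \<in> cuts B. k \<le> j}"
proof -
  let ?w = "A' @ [a] @ B @ [n]" and ?l = "Suc (length A')" and ?m = "length B"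
  have low: "j \<in> cuts ?w \<longleftrightarrow> j \<in> cuts (A' @ [a])" if "j < ?l" for j
  proof -
    have "set (take j A') \<subseteq> set A'" by (rule set_take_subset)
    then show ?thesis
      using that A' A'B n by (auto simp: cuts_def intro: less_trans)
  qed
  have lA: "?l \<in> cuts (A' @ [a])" by (simp add: cuts_def)
  have mid: "?l + j \<in> cuts ?w \<longleftrightarrow> j \<in> cuts B \<and> k \<le> j" if "j \<le> ?m" for j
  proof
    assume *: "?l + j \<in> cuts ?w"
    then have **: "\<forall>x\<in>insert a (set A' \<union> set (take j B)). \<forall>y\<in>insert n (set (drop j B)). x < y"
      using that by (simp add: cuts_def)
    have "k \<le> j"
    proof (rule ccontr)
      assume "\<not> k \<le> j"
      then have jk: "j < k" "j < length B" using k(1) by auto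
      then have "B ! j \<in> set (drop j B)" by (metis Cons_nth_drop_Suc list.set_intros(1))
      moreover have "B ! j \<in> set (take k B)" using jk by (auto simp: in_set_conv_nth intro!: exI [of _ j])
      ultimately show False using ** k(2) by (metis insertI1 insertI2 less_asym)
    qed
    then show "j \<in> cuts B \<and> k \<le> j" using ** that by (auto simp: cuts_def)
  next
    assume *: "j \<in> cuts B \<and> k \<le> j"
    have 1: "x < y" if "x \<in> insert a (set A')" "y \<in> insert n (set (drop j B))" for x y
      using that * A' A'B n k(3) set_drop_subset_set_drop [of k j B] set_drop_subset [of j B]
      by (auto intro: less_trans)
    have 2: "x < y" if "x \<in> set (take j B)" "y \<in> insert n (set (drop j B))" for x y
      using that * n(2) by (auto simp: cuts_def dest: in_set_takeD)
    show "?l + j \<in> cuts ?w" using 1 2 that by (auto simp: cuts_def)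
  qed
  have last: "?l + Suc ?m \<in> cuts ?w" by (simp add: cuts_def)
  have "cuts ?w = (cuts (A' @ [a]) - {?l}) \<union> (\<lambda>j. ?l + j) ` {j \<in> cuts B. k \<le> j} \<union> {?l + Suc ?m}"
    (is "_ = ?X \<union> ?Y \<union> ?Z")
  proof (intro set_eqI)
    fix i
    consider "i < ?l" | "?l \<le> i" "i \<le> ?l + ?m" | "i = ?l + Suc ?m" | "i > ?l + Suc ?m"
      by linarith
    then show "i \<in> cuts ?w \<longleftrightarrow> i \<in> ?X \<union> ?Y \<union> ?Z"
    proof cases
      case 1
      then show ?thesis using low by auto
    next
      case 2
      then obtain j where "i = ?l + j" "j \<le> ?m" by (metis le_add_diff_inverse nat_add_left_cancel_le)
      then show ?thesis using mid [of j] by (auto simp: cuts_def)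
    next
      case 3
      then show ?thesis using last by simp
    next
      case 4
      then show ?thesis by (auto simp: cuts_def)
    qed
  qed
  moreover have "?X \<inter> ?Y = {}" "(?X \<union> ?Y) \<inter> ?Z = {}" by (auto simp: cuts_def)
  moreover have "card ?Y = card {j \<in> cuts B. k \<le> j}" by (intro card_image) (auto simp: inj_on_def)
  moreover have "Suc (card ?X) = card (cuts (A' @ [a]))" using lA by (metis card_Suc_Diff1 finite_cuts)
  ultimately show ?thesis by (simp add: card_Un_disjoint)
qed

text \<open>
  The numbers \<open>card {j \<in> K. k \<le> j}\<close> run through \<open>1, \<dots>, card K\<close>, so the sum is geometric.
\<close>

lemma sum_powers_of_ranks:
  fixes u :: "'a::comm_ring_1"
  assumes "finite (K :: nat set)"
  shows "(u - 1) * (\<Sum>k\<in>K. u ^ card {j \<in> K. k \<le> j}) = u * (u ^ card K - 1)"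
  using assms
proof (induction K rule: finite_linorder_min_induct)
  case (insert b K)
  have "{j \<in> insert b K. k \<le> j} = {j \<in> K. k \<le> j}" if "k \<in> K" for k
    using insert.hyps(2) that by auto
  moreover have "{j \<in> insert b K. b \<le> j} = insert b K" using insert.hyps(2) by (auto intro: less_imp_le)
  moreover have "b \<notin> K" using insert.hyps(2) by auto
  ultimately show ?case using insert.IH insert.hyps(1) by (simp add: algebra_simps)
qed simp

section \<open>Full and decreasing trees\<close>

lemma full_tree_Node:
  "full_tree (Node l a r) \<longleftrightarrow> (l = Leaf \<and> r = Leaf) \<or> (full_tree l \<and> full_tree r)"
proof -
  have "full_tree (Node l a r) \<longleftrightarrow> (l = Leaf \<longleftrightarrow> r = Leaf) \<and>
     (\<forall>l' a' r'. Node l' a' r' \<in> subtrees l \<longrightarrow> (l' = Leaf \<longleftrightarrow> r' = Leaf)) \<and>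
     (\<forall>l' a' r'. Node l' a' r' \<in> subtrees r \<longrightarrow> (l' = Leaf \<longleftrightarrow> r' = Leaf))"
    by (simp add: full_tree_def) blast
  moreover have "l = Leaf \<Longrightarrow> Node l' a' r' \<notin> subtrees l" "r = Leaf \<Longrightarrow> Node l' a' r' \<notin> subtrees r" for l' a' r'
    by auto
  ultimately show ?thesis unfolding full_tree_def by blast
qed

lemma full_tree_Leaf [simp]: "\<not> full_tree Leaf"
  by (simp add: full_tree_def)

lemma decreasing_tree_Leaf [simp]: "decreasing_tree Leaf"
  by (simp add: decreasing_tree_def)

lemma decreasing_tree_Node_value:
  "decreasing_tree (Node l a r) \<longleftrightarrow> decreasing_tree l \<and> decreasing_tree r \<and>
     (\<forall>c\<in>{l, r}. c \<noteq> Leaf \<longrightarrow> value c < a)"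
  by (simp add: decreasing_tree_def) blast

lemma decreasing_tree_le_value: "decreasing_tree t \<Longrightarrow> x \<in> set_tree t \<Longrightarrow> x \<le> value t"
proof (induction t)
  case (Node l a r)
  then show ?case
    unfolding decreasing_tree_Node_value
    by (auto dest!: Node.IH)
qed simp

text \<open>
  The definition compares each label with the labels of the children only; the comparison with all
  descendants is what makes the label of the root a maximum.
\<close>

lemma decreasing_tree_Node:
  "decreasing_tree (Node l a r) \<longleftrightarrow> decreasing_tree l \<and> decreasing_tree r \<and>
     (\<forall>x\<in>set_tree l \<union> set_tree r. x < a)"
proof -
  have "(t \<noteq> Leaf \<longrightarrow> value t < a) \<longleftrightarrow> (\<forall>x\<in>set_tree t. x < a)" if "decreasing_tree t" for t
    using decreasing_tree_le_value [OF that] by (cases t) (auto intro: le_less_trans)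
  then show ?thesis unfolding decreasing_tree_Node_value by auto
qed

lemma full_tree_map: "full_tree (map_tree f t) \<longleftrightarrow> full_tree t"
  by (induction t) (auto simp: full_tree_Node)

lemma decreasing_tree_map:
  assumes "strict_mono_on V f" "set_tree t \<subseteq> V"
  shows "decreasing_tree (map_tree f t) \<longleftrightarrow> decreasing_tree t"
  using assms(2)
proof (induction t)
  case (Node l a r)
  have "f x < f a \<longleftrightarrow> x < a" if "x \<in> set_tree l \<union> set_tree r" for x
    using strict_mono_on_less [OF assms(1)] Node.prems that by auto
  then have "(\<forall>x\<in>set_tree (map_tree f l) \<union> set_tree (map_tree f r). x < f a) \<longleftrightarrow>
    (\<forall>x\<in>set_tree l \<union> set_tree r. x < a)"
    by (simp add: tree.set_map ball_Un)
  then show ?case using Node by (simp add: decreasing_tree_Node)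
qed simp

section \<open>Standardizing the labels\<close>

text \<open>
  For \<open>V = {1..n}\<close> these are the trees that are counted; arbitrary label sets are allowed because the
  two subtrees of the root carry labels that are not consecutive.
\<close>

definition trees_on :: "nat set \<Rightarrow> nat tree set" where
  "trees_on V = {t. set_tree t = V \<and> distinct (postorder t) \<and> decreasing_tree t \<and> full_tree t
                    \<and> avoids_231 (postorder t)}"

abbreviation tree_cuts :: "nat tree \<Rightarrow> nat set" where
  "tree_cuts t \<equiv> cuts (postorder t)"

lemma trees_on_empty [simp]: "trees_on {} = {}"
  by (auto simp: trees_on_def)

lemma size_trees_on: "t \<in> trees_on V \<Longrightarrow> size t = card V"
  by (auto simp: trees_on_def) (metis distinct_card length_postorder set_postorder)

lemma finite_trees_of_size:
  assumes "finite V"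
  shows "finite {t. set_tree t \<subseteq> V \<and> size t \<le> n}"
proof (induction n)
  case 0
  have "{t. set_tree t \<subseteq> V \<and> size t \<le> 0} = {Leaf}" by auto
  then show ?case by (metis finite.simps)
next
  case (Suc n)
  let ?S = "{t. set_tree t \<subseteq> V \<and> size t \<le> n}"
  have "{t. set_tree t \<subseteq> V \<and> size t \<le> Suc n} \<subseteq> insert Leaf ((\<lambda>(l, a, r). Node l a r) ` (?S \<times> V \<times> ?S))"
  proof
    fix t assume "t \<in> {t. set_tree t \<subseteq> V \<and> size t \<le> Suc n}"
    then show "t \<in> insert Leaf ((\<lambda>(l, a, r). Node l a r) ` (?S \<times> V \<times> ?S))"
      by (cases t) (auto simp: image_iff)
  qed
  moreover have "finite (insert Leaf ((\<lambda>(l, a, r). Node l a r) ` (?S \<times> V \<times> ?S)))"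
    using Suc.IH assms by simp
  ultimately show ?case by (rule finite_subset)
qed

lemma finite_trees_on: "finite V \<Longrightarrow> finite (trees_on V)"
  by (rule finite_subset [OF _ finite_trees_of_size [of V "card V"]])
     (auto simp: size_trees_on, auto simp: trees_on_def)

lemma map_tree_trees_on:
  assumes "strict_mono_on V f" "t \<in> trees_on V"
  shows "map_tree f t \<in> trees_on (f ` V)" and "tree_cuts (map_tree f t) = tree_cuts t"
proof -
  have t: "set_tree t = V" "distinct (postorder t)" "decreasing_tree t" "full_tree t"
    "avoids_231 (postorder t)"
    using assms(2) by (auto simp: trees_on_def)
  have "inj_on f V" using assms(1) by (rule strict_mono_on_imp_inj_on)
  then show "map_tree f t \<in> trees_on (f ` V)"
    using t avoids_231_map [OF assms(1), of "postorder t"]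
    by (simp add: trees_on_def tree.set_map postorder_map distinct_map full_tree_map
        decreasing_tree_map [OF assms(1)])
  show "tree_cuts (map_tree f t) = tree_cuts t"
    using t by (simp add: postorder_map cuts_map [OF assms(1)])
qed

text \<open>
  Avoidance, cuts, fullness and the decreasing condition only depend on the relative order of the labels,
  so the increasing bijection of \<open>V\<close> onto an initial segment transports the trees and their cuts.
\<close>

lemma sum_trees_on_standardize:
  assumes "finite V"
  shows "(\<Sum>t\<in>trees_on V. g (tree_cuts t)) = (\<Sum>t\<in>trees_on {1..card V}. g (tree_cuts t))"
proof -
  define f where "f v = card {w \<in> V. w \<le> v}" for v
  have f: "strict_mono_on V f"
  proof (rule strict_mono_onI)
    fix v w assume "v \<in> V" "w \<in> V" "v < w"
    then have "{x \<in> V. x \<le> v} \<subseteq> {x \<in> V. x \<le> w}" "w \<in> {x \<in> V. x \<le> w} - {x \<in> V. x \<le> v}" by auto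
    then have "{x \<in> V. x \<le> v} \<subset> {x \<in> V. x \<le> w}" by blast
    then show "f v < f w" unfolding f_def using assms by (simp add: psubset_card_mono)
  qed
  then have inj: "inj_on f V" by (rule strict_mono_on_imp_inj_on)
  have "f ` V \<subseteq> {1..card V}"
    using assms by (auto simp: f_def card_mono Suc_le_eq card_gt_0_iff)
  then have img: "f ` V = {1..card V}"
    by (simp add: card_image [OF inj] card_subset_eq)
  define h where "h = inv_into V f"
  have h: "strict_mono_on {1..card V} h"
  proof (rule strict_mono_onI)
    fix i j assume ij: "i \<in> {1..card V}" "j \<in> {1..card V}" "i < j"
    then have "h i \<in> V" "h j \<in> V" "f (h i) = i" "f (h j) = j"
      unfolding h_def img [symmetric] by (auto simp: inv_into_into f_inv_into_f)
    then show "h i < h j" using strict_mono_on_less [OF f] ij(3) by metis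
  qed
  have himg: "h ` {1..card V} = V"
    unfolding h_def img [symmetric] using inj by (simp add: inv_into_image_cancel)
  have hf: "h (f v) = v" if "v \<in> V" for v
    using that inj by (simp add: h_def)
  have fh: "f (h i) = i" if "i \<in> {1..card V}" for i
    using that unfolding h_def img [symmetric] by (rule f_inv_into_f)
  show ?thesis
  proof (rule sum.reindex_bij_witness [where i = "map_tree h" and j = "map_tree f"])
    fix t assume t: "t \<in> trees_on V"
    then have V: "set_tree t = V" by (simp add: trees_on_def)
    show "map_tree h (map_tree f t) = t"
      unfolding tree.map_comp by (rule tree.map_ident_strong) (use V hf in auto)
    show "map_tree f t \<in> trees_on {1..card V}"
      using map_tree_trees_on(1) [OF f t] img by simp
    show "g (tree_cuts (map_tree f t)) = g (tree_cuts t)"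
      using map_tree_trees_on(2) [OF f t] by simp
  next
    fix t assume t: "t \<in> trees_on {1..card V}"
    then have V: "set_tree t = {1..card V}" by (simp add: trees_on_def)
    show "map_tree f (map_tree h t) = t"
      unfolding tree.map_comp by (rule tree.map_ident_strong) (use V fh in auto)
    show "map_tree h t \<in> trees_on V"
      using map_tree_trees_on(1) [OF h t] himg by simp
  qed
qed

lemma down_closed_eq:
  assumes "S \<subseteq> {1..m::nat}" "\<And>x y. x \<in> S \<Longrightarrow> y \<in> {1..m} - S \<Longrightarrow> x < y"
  shows "S = {1..card S}"
proof -
  have "finite S" using assms(1) finite_subset by blast
  have "S \<subseteq> {1..card S}"
  proof
    fix x assume x: "x \<in> S"
    have "{1..x} \<subseteq> S"
    proof
      fix y assume "y \<in> {1..x}"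
      then show "y \<in> S" using assms(2) [OF x, of y] x assms(1) by (cases "y \<in> S") auto
    qed
    then have "card {1..x} \<le> card S" using \<open>finite S\<close> by (rule card_mono [rotated])
    then show "x \<in> {1..card S}" using x assms(1) by auto
  qed
  then show ?thesis by (simp add: card_subset_eq)
qed

section \<open>Removing the root\<close>

text \<open>
  Let the root have the label \<open>Suc m\<close>, and let the left subtree have \<open>i\<close> vertices, with largest label
  \<open>a\<close>. Since \<open>a\<close> ends the postorder reading of the left subtree, every other label \<open>x\<close> there would
  form a 231 pattern \<open>x a z\<close> with a smaller label \<open>z\<close> of the right subtree. So these \<open>i - 1\<close> labels are
  the smallest ones, and \<open>a = i + k\<close>, where \<open>k\<close> labels of the right subtree are below \<open>a\<close>. Given
  that both subtrees avoid 231, the only other requirement is that \<open>a\<close> splits the reading of the right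
  subtree, that is, that \<open>k\<close> is one of its cuts.
\<close>

definition left_labels :: "nat \<Rightarrow> nat \<Rightarrow> nat set" where
  "left_labels i k = insert (i + k) {1..<i}"

definition right_labels :: "nat \<Rightarrow> nat \<Rightarrow> nat \<Rightarrow> nat set" where
  "right_labels m i k = {i..m} - {i + k}"

definition joins :: "nat \<Rightarrow> (nat \<times> nat \<times> nat tree \<times> nat tree) set" where
  "joins m = (SIGMA i:{1..m}. SIGMA k:{..m - i}. trees_on (left_labels i k) \<times>
       {R \<in> trees_on (right_labels m i k). k \<in> tree_cuts R})"

lemma card_left_labels: "1 \<le> i \<Longrightarrow> card (left_labels i k) = i"
  by (simp add: left_labels_def)

lemma card_right_labels: "i \<le> m \<Longrightarrow> k \<le> m - i \<Longrightarrow> card (right_labels m i k) = m - i"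
  by (simp add: right_labels_def)

lemma postorder_snoc: "t \<noteq> Leaf \<Longrightarrow> \<exists>w. postorder t = w @ [value t]"
  by (cases t) auto

lemma join_props:
  assumes "(i, k, L, R) \<in> joins m"
  shows "Node L (Suc m) R \<in> trees_on {1..Suc m}"
    and "card (tree_cuts (Node L (Suc m) R)) = card (tree_cuts L) + card {j \<in> tree_cuts R. k \<le> j}"
proof -
  have ik: "1 \<le> i" "i \<le> m" "k \<le> m - i" and L: "L \<in> trees_on (left_labels i k)"
    and R: "R \<in> trees_on (right_labels m i k)" and cut: "k \<in> tree_cuts R"
    using assms by (auto simp: joins_def)
  note L' = L [unfolded trees_on_def left_labels_def mem_Collect_eq]
  note R' = R [unfolded trees_on_def right_labels_def mem_Collect_eq]
  let ?B = "postorder R" and ?a = "i + k"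
  have "L \<noteq> Leaf" using L' by auto
  moreover have "value L = ?a"
  proof -
    have "value L \<in> set_tree L" using \<open>L \<noteq> Leaf\<close> by (cases L) auto
    moreover have "?a \<le> value L" using L' decreasing_tree_le_value [of L ?a] by auto
    ultimately show ?thesis using L' by auto
  qed
  ultimately obtain A where A: "postorder L = A @ [?a]" using postorder_snoc by metis
  have "insert ?a (set A) = insert ?a {1..<i}"
    using A L' set_postorder [of L] by simp
  moreover have "?a \<notin> set A" using A L' by simp
  moreover have "?a \<notin> {1..<i}" by simp
  ultimately have setA: "set A = {1..<i}" using insert_ident by metis
  have setB: "set ?B = {i..m} - {?a}" using R' by simp
  have k: "card {y \<in> set ?B. y < ?a} = k"
  proof -
    have "?a \<le> m" using ik by simp
    then have "{y \<in> set ?B. y < ?a} = {i..<i + k}" unfolding setB by auto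
    then show ?thesis by simp
  qed
  have aB: "?a \<notin> set ?B" unfolding setB by simp
  have sp: "splits ?a ?B" using splits_iff_cut [OF aB] cut k R' by simp
  have k_eq: "k = length (filter (\<lambda>y. y < ?a) ?B)"
    using k R' by (metis distinct_card distinct_filter set_filter)
  have split: "\<And>y. y \<in> set (take k ?B) \<Longrightarrow> y < ?a" "\<And>y. y \<in> set (drop k ?B) \<Longrightarrow> ?a < y"
    using splits_imp_take_drop [OF sp aB k_eq] by blast+
  have "avoids_231 (postorder L @ ?B)"
  proof -
    have "splits x ?B" if "x \<in> set (postorder L)" for x
    proof (cases "x = ?a")
      case False
      then have "x < i" using that L' by auto
      then show ?thesis using setB by (intro splits_if_ge) auto
    qed (use sp in simp)
    moreover have "sorted_wrt (\<lambda>x y. \<forall>z\<in>set ?B. \<not> (z < x \<and> x < y)) (postorder L)"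
    proof -
      have "sorted_wrt (\<lambda>x y. \<forall>z\<in>set ?B. \<not> (z < x \<and> x < y)) xs" if "\<forall>x\<in>set xs. x < i" for xs
        using that setB by (induction xs) auto
      then show ?thesis using setA setB by (subst A) (auto simp: sorted_wrt_append)
    qed
    ultimately show ?thesis using L' R' by (simp add: avoids_231_append)
  qed
  moreover have "\<forall>y\<in>set (postorder L @ ?B). y < Suc m"
    using L' R' ik by auto
  ultimately have av: "avoids_231 ((postorder L @ ?B) @ [Suc m])"
    by (subst avoids_231_snoc_max) auto
  have am: "?a \<le> m" using ik by simp
  have un: "set_tree L \<union> set_tree R = {1..m}" and disj: "set_tree L \<inter> set_tree R = {}"
    unfolding conjunct1 [OF L'] conjunct1 [OF R'] using am ik(1) by auto
  have "\<forall>x\<in>set_tree L \<union> set_tree R. x < Suc m" unfolding un by auto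
  then have dec: "decreasing_tree (Node L (Suc m) R)" using L' R' by (simp add: decreasing_tree_Node)
  have "set_tree (Node L (Suc m) R) = insert (Suc m) {1..m}" unfolding un [symmetric] by simp
  also have "\<dots> = {1..Suc m}" by auto
  finally have set: "set_tree (Node L (Suc m) R) = {1..Suc m}" .
  have "Suc m \<notin> set_tree L \<union> set_tree R" unfolding un by simp
  then have "distinct (postorder (Node L (Suc m) R))" using L' R' disj by simp
  moreover have "full_tree (Node L (Suc m) R)" using L' R' by (simp add: full_tree_Node)
  moreover have "avoids_231 (postorder (Node L (Suc m) R))" using av by simp
  ultimately show "Node L (Suc m) R \<in> trees_on {1..Suc m}"
    using set dec by (simp only: trees_on_def mem_Collect_eq)
  have "k \<le> length ?B" using cut by (simp add: cuts_def)
  have "card (cuts (A @ [?a] @ ?B @ [Suc m])) = card (cuts (A @ [?a])) + card {j \<in> cuts ?B. k \<le> j}"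
  proof (rule cuts_join)
    show "x < ?a" if "x \<in> set A" for x using that unfolding setA by simp
    show "x < y" if "x \<in> set A" "y \<in> set ?B" for x y using that unfolding setA setB by simp
    show "y < Suc m" if "y \<in> set ?B" for y using that unfolding setB by simp
  qed (use split am \<open>k \<le> length ?B\<close> in simp_all)
  then show "card (tree_cuts (Node L (Suc m) R)) = card (tree_cuts L) + card {j \<in> tree_cuts R. k \<le> j}"
    using A by (metis append.assoc postorder.simps(2))
qed

text \<open>
  The number \<open>i\<close> is the size of the left subtree, and \<open>i + k\<close> is its largest label.
\<close>

lemma join_unique:
  assumes "(i, k, L, R) \<in> joins m" "(i', k', L, R) \<in> joins m"
  shows "i = i' \<and> k = k'"
proof -
  have L: "L \<in> trees_on (left_labels i k)" "L \<in> trees_on (left_labels i' k')" and "1 \<le> i" "1 \<le> i'"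
    using assms by (auto simp: joins_def)
  then have "i = i'" using size_trees_on card_left_labels by metis
  moreover have "insert (i + k) {1..<i} = insert (i' + k') {1..<i'}"
    using L by (auto simp: trees_on_def left_labels_def)
  ultimately show ?thesis by (metis add_left_cancel atLeastLessThan_iff insertE insertI1 not_add_less1)
qed

lemma trees_on_imp_join:
  assumes t: "t \<in> trees_on {1..Suc m}" and "0 < m"
  shows "\<exists>i k L R. (i, k, L, R) \<in> joins m \<and> t = Node L (Suc m) R"
proof -
  have "t \<noteq> Leaf" using t by (auto simp: trees_on_def)
  then obtain L a R where t_eq: "t = Node L a R" by (cases t) auto
  have T: "insert a (set_tree L \<union> set_tree R) = {1..Suc m}" "distinct (postorder L @ postorder R @ [a])"
    "decreasing_tree L" "decreasing_tree R" "\<forall>x\<in>set_tree L \<union> set_tree R. x < a"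
    "full_tree t" "avoids_231 ((postorder L @ postorder R) @ [a])"
    using t by (auto simp: trees_on_def t_eq decreasing_tree_Node)
  have a: "a = Suc m"
  proof (rule antisym)
    show "a \<le> Suc m" using T(1) by auto
    have "Suc m \<in> insert a (set_tree L \<union> set_tree R)" using T(1) by auto
    then show "Suc m \<le> a" using T(5) by (auto intro: less_imp_le)
  qed
  have LR: "set_tree L \<union> set_tree R = {1..m}"
  proof -
    have "a \<notin> set_tree L \<union> set_tree R" using T(5) by blast
    then have "set_tree L \<union> set_tree R = {1..Suc m} - {a}" using T(1) by auto
    moreover have "{1..Suc m} - {Suc m} = {1..m}" by auto
    ultimately show ?thesis using a by simp
  qed
  have "1 \<in> set_tree L \<union> set_tree R" unfolding LR using \<open>0 < m\<close> by simp
  then have "\<not> (L = Leaf \<and> R = Leaf)" by auto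
  then have full: "full_tree L" "full_tree R" using T(6) unfolding t_eq full_tree_Node by blast+
  define c where "c = value L"
  define B where "B = postorder R"
  have "L \<noteq> Leaf" using full(1) by auto
  then obtain A where A: "postorder L = A @ [c]" using postorder_snoc c_def by blast
  have setL: "set_tree L = insert c (set A)" using A set_postorder [of L] by simp
  have disj: "distinct A" "distinct B" "c \<notin> set A" "c \<notin> set B" "set A \<inter> set B = {}"
    using T(2) unfolding A B_def [symmetric] by auto
  have Ac: "x < c" if "x \<in> set A" for x
    using decreasing_tree_le_value [OF T(3), of x] that disj(3) setL c_def by (metis insertI2 le_neq_implies_less)
  have all: "insert c (set A) \<union> set B = {1..m}" using LR setL by (simp add: B_def)
  have av: "avoids_231 (A @ [c])" "avoids_231 B" "\<forall>x\<in>set (A @ [c]). splits x B"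
    "sorted_wrt (\<lambda>x y. \<forall>z\<in>set B. \<not> (z < x \<and> x < y)) (A @ [c])"
  proof -
    have "avoids_231 (postorder L @ postorder R)"
      using T(7) by (subst (asm) avoids_231_snoc_max) (use T(5) in auto)
    then show "avoids_231 (A @ [c])" "avoids_231 B" "\<forall>x\<in>set (A @ [c]). splits x B"
      "sorted_wrt (\<lambda>x y. \<forall>z\<in>set B. \<not> (z < x \<and> x < y)) (A @ [c])"
      unfolding A B_def [symmetric] avoids_231_append [of "A @ [c]"] by auto
  qed
  have AB: "x < z" if "x \<in> set A" "z \<in> set B" for x z
  proof -
    have "\<not> (z < x \<and> x < c)" using av(4) that by (auto simp: sorted_wrt_append)
    then show ?thesis using Ac that disj(5) by (metis disjoint_iff linorder_neqE_nat)
  qed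
  define i where "i = Suc (card (set A))"
  have setA: "set A = {1..<i}"
  proof -
    have "set A = {1..card (set A)}"
    proof (rule down_closed_eq)
      show "set A \<subseteq> {1..m}" using all by auto
      show "x < y" if "x \<in> set A" "y \<in> {1..m} - set A" for x y
        using that(2) Ac [OF that(1)] AB [OF that(1)] unfolding all [symmetric] by blast
    qed
    then show ?thesis unfolding i_def by (simp add: atLeastLessThanSuc_atLeastAtMost)
  qed
  have ci: "i \<le> c" "c \<le> m" "1 \<le> i" "i \<le> m"
  proof -
    have "1 \<le> c" "c \<le> m" using all by auto
    moreover have "c \<notin> {1..<i}" using disj(3) setA by simp
    ultimately show "i \<le> c" "c \<le> m" by auto
    then show "i \<le> m" by simp
    show "1 \<le> i" by (simp add: i_def)
  qed
  define k where "k = c - i"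
  have ck: "c = i + k" "k \<le> m - i" using ci by (auto simp: k_def)
  have setB: "set B = {i..m} - {i + k}"
  proof -
    have "set B = {1..m} - insert c (set A)" using disj unfolding all [symmetric] by blast
    also have "\<dots> = {i..m} - {i + k}" unfolding setA ck(1) using ci(3) by auto
    finally show ?thesis .
  qed
  have "card {y \<in> set B. y < i + k} = k"
  proof -
    have "i + k \<le> m" using ck ci by simp
    then have "{y \<in> set B. y < i + k} = {i..<i + k}" unfolding setB by auto
    then show ?thesis by simp
  qed
  moreover have "splits (i + k) B" using av(3) ck by simp
  ultimately have "k \<in> cuts B"
    using splits_iff_cut [of "i + k" B] disj(2,4) ck(1) by simp
  moreover have "L \<in> trees_on (left_labels i k)"
    using T(3) av(1) full(1) A setL setA ck(1) disj(1,3) by (simp add: trees_on_def left_labels_def)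
  moreover have "R \<in> trees_on (right_labels m i k)"
    using T(4) av(2) full(2) setB disj(2) by (simp add: trees_on_def right_labels_def B_def)
  ultimately have "(i, k, L, R) \<in> joins m" using ci ck by (simp add: joins_def B_def)
  then show ?thesis using t_eq a by blast
qed

lemma bij_betw_joins:
  assumes "0 < m"
  shows "bij_betw (\<lambda>(i, k, L, R). Node L (Suc m) R) (joins m) (trees_on {1..Suc m})"
proof (rule bij_betwI')
  fix p q assume "p \<in> joins m" "q \<in> joins m"
  then show "((\<lambda>(i, k, L, R). Node L (Suc m) R) p = (\<lambda>(i, k, L, R). Node L (Suc m) R) q) \<longleftrightarrow> p = q"
    using join_unique by (cases p; cases q) auto
next
  fix p assume "p \<in> joins m"
  then show "(\<lambda>(i, k, L, R). Node L (Suc m) R) p \<in> trees_on {1..Suc m}"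
    using join_props(1) by (cases p) auto
next
  fix t assume "t \<in> trees_on {1..Suc m}"
  then show "\<exists>p\<in>joins m. t = (\<lambda>(i, k, L, R). Node L (Suc m) R) p"
  proof -
    obtain i k L R where "(i, k, L, R) \<in> joins m" "t = Node L (Suc m) R"
      using trees_on_imp_join [OF \<open>t \<in> _\<close> assms] by blast
    then show ?thesis by (intro bexI [of _ "(i, k, L, R)"]) auto
  qed
qed

section \<open>The functional equation\<close>

definition cut_weight :: "nat \<Rightarrow> 'a::comm_ring_1 \<Rightarrow> 'a" where
  "cut_weight n u = (\<Sum>t\<in>trees_on {1..n}. u ^ card (tree_cuts t))"

lemma cut_weight_0 [simp]: "cut_weight 0 u = 0"
  by (simp add: cut_weight_def)

lemma trees_on_1: "trees_on {1..Suc 0} = {Node Leaf 1 Leaf}"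
proof -
  have "t = Node Leaf 1 Leaf" if "t \<in> trees_on {Suc 0}" for t
  proof -
    have "size t = 1" "set_tree t = {1}" using size_trees_on [OF that] that by (auto simp: trees_on_def)
    then show ?thesis by (cases t) auto
  qed
  moreover have "Node Leaf 1 Leaf \<in> trees_on {Suc 0}"
    by (simp add: trees_on_def full_tree_Node decreasing_tree_Node)
  ultimately have "trees_on {Suc 0} = {Node Leaf 1 Leaf}" by blast
  then show ?thesis by simp
qed

lemma cut_weight_1: "cut_weight (Suc 0) u = u ^ 2"
proof -
  have "cuts [Suc 0] = {0, 1}" by (auto simp: cuts_def le_Suc_eq)
  then show ?thesis by (simp add: cut_weight_def trees_on_1 [simplified] power2_eq_square)
qed

text \<open>
  By the decomposition, a pair of subtrees contributes one tree for each cut \<open>k\<close> of the right subtree,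
  and that tree has as many cuts as the left subtree has, plus the number of cuts of the right subtree
  that are at least \<open>k\<close>. Summed over \<open>k\<close>, the right subtree contributes a geometric sum, which the
  factor \<open>u - 1\<close> turns into \<open>u\<close> times the difference of the weights at \<open>u\<close> and at \<open>1\<close>.
\<close>

lemma cut_weight_Suc:
  fixes u :: "'a::comm_ring_1"
  assumes "0 < m"
  shows "(u - 1) * cut_weight (Suc m) u =
    u * (\<Sum>i\<le>m. cut_weight i u * (cut_weight (m - i) u - cut_weight (m - i) 1))"
proof -
  let ?w = "\<lambda>t. u ^ card (tree_cuts t)"
  let ?r = "\<lambda>k K. if k \<in> K then u ^ card {j \<in> K. k \<le> j} else 0"
  have finL: "finite (trees_on (left_labels i k))" and finR: "finite (trees_on (right_labels m i k))" for i k
    by (simp_all add: finite_trees_on left_labels_def right_labels_def)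
  have right: "(u - 1) * (\<Sum>k\<le>n. \<Sum>R\<in>trees_on {1..n}. ?r k (tree_cuts R))
                = u * (cut_weight n u - cut_weight n 1)" for n
  proof -
    have "(u - 1) * (\<Sum>k\<le>n. ?r k (tree_cuts R)) = u * (?w R - 1)" if "R \<in> trees_on {1..n}" for R
    proof -
      have "tree_cuts R \<subseteq> {..n}" using size_trees_on [OF that] by (auto simp: cuts_def)
      then have "(\<Sum>k\<le>n. ?r k (tree_cuts R)) = (\<Sum>k\<in>tree_cuts R. u ^ card {j \<in> tree_cuts R. k \<le> j})"
        by (intro sum.mono_neutral_cong_right) auto
      then show ?thesis using sum_powers_of_ranks [of "tree_cuts R" u] by simp
    qed
    then have "(\<Sum>R\<in>trees_on {1..n}. (u - 1) * (\<Sum>k\<le>n. ?r k (tree_cuts R)))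
               = (\<Sum>R\<in>trees_on {1..n}. u * (?w R - 1))" by (intro sum.cong) auto
    then show ?thesis
      by (subst sum.swap)
         (simp add: cut_weight_def sum_distrib_left [symmetric] sum_subtractf)
  qed
  have "cut_weight (Suc m) u = (\<Sum>p\<in>joins m. ?w ((\<lambda>(i, k, L, R). Node L (Suc m) R) p))"
    unfolding cut_weight_def by (rule sum.reindex_bij_betw [OF bij_betw_joins [OF assms], symmetric])
  also have "\<dots> = (\<Sum>(i, k, L, R)\<in>joins m. ?w L * u ^ card {j \<in> tree_cuts R. k \<le> j})"
    by (intro sum.cong refl) (auto simp: join_props(2) power_add simp del: postorder.simps)
  also have "\<dots> = (\<Sum>i\<in>{1..m}. \<Sum>k\<le>m - i. \<Sum>L\<in>trees_on (left_labels i k).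
      \<Sum>R\<in>{R \<in> trees_on (right_labels m i k). k \<in> tree_cuts R}. ?w L * u ^ card {j \<in> tree_cuts R. k \<le> j})"
    unfolding joins_def using finL finR
    by (simp add: sum.Sigma [symmetric] sum.cartesian_product [symmetric] finite_SigmaI)
  also have "\<dots> = (\<Sum>i\<in>{1..m}. \<Sum>k\<le>m - i. (\<Sum>L\<in>trees_on (left_labels i k). ?w L) *
      (\<Sum>R\<in>trees_on (right_labels m i k). ?r k (tree_cuts R)))"
    using finR by (simp add: sum_product sum.inter_filter if_distrib [of "\<lambda>x. _ * x"] cong: if_cong)
  also have "\<dots> = (\<Sum>i\<in>{1..m}. \<Sum>k\<le>m - i. cut_weight i u * (\<Sum>R\<in>trees_on {1..m - i}. ?r k (tree_cuts R)))"
  proof (intro sum.cong refl)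
    fix i k assume ik: "i \<in> {1..m}" "k \<in> {..m - i}"
    have "(\<Sum>L\<in>trees_on (left_labels i k). ?w L) = cut_weight i u"
      using sum_trees_on_standardize [of "left_labels i k" "\<lambda>K. u ^ card K"] ik
      by (simp add: card_left_labels cut_weight_def) (simp add: left_labels_def)
    moreover have "(\<Sum>R\<in>trees_on (right_labels m i k). ?r k (tree_cuts R))
                     = (\<Sum>R\<in>trees_on {1..m - i}. ?r k (tree_cuts R))"
    proof -
      have "finite (right_labels m i k)" by (simp add: right_labels_def)
      then show ?thesis
        using sum_trees_on_standardize [of "right_labels m i k" "?r k"] ik by (simp only: card_right_labels atLeastAtMost_iff atMost_iff)
    qed
    ultimately show "(\<Sum>L\<in>trees_on (left_labels i k). ?w L) *
        (\<Sum>R\<in>trees_on (right_labels m i k). ?r k (tree_cuts R))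
      = cut_weight i u * (\<Sum>R\<in>trees_on {1..m - i}. ?r k (tree_cuts R))"
      by (simp only:)
  qed
  finally have "(u - 1) * cut_weight (Suc m) u = (\<Sum>i\<in>{1..m}. cut_weight i u *
      ((u - 1) * (\<Sum>k\<le>m - i. \<Sum>R\<in>trees_on {1..m - i}. ?r k (tree_cuts R))))"
    by (simp only: sum_distrib_left mult.left_commute)
  also have "\<dots> = (\<Sum>i\<in>{1..m}. u * (cut_weight i u * (cut_weight (m - i) u - cut_weight (m - i) 1)))"
    unfolding right by (simp only: mult.left_commute)
  also have "\<dots> = (\<Sum>i\<le>m. u * (cut_weight i u * (cut_weight (m - i) u - cut_weight (m - i) 1)))"
    by (intro sum.mono_neutral_left) (auto simp: not_le less_Suc_eq)
  finally show ?thesis by (simp only: sum_distrib_left)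
qed

text \<open>
  This is \<open>(u - 1) F(u) = z u\<^sup>2 (u - 1) + z u F(u) (F(u) - F(1))\<close>. The first summand on the right is
  the one-vertex tree, whose reading has two cuts.
\<close>

lemma cut_gf_equation:
  fixes u :: "'a::comm_ring_1"
  defines "F \<equiv> \<lambda>v. Abs_fps (\<lambda>n. cut_weight n v)"
  shows "fps_const (u - 1) * F u = fps_X * fps_const (u^2 * (u - 1))
           + fps_X * fps_const u * F u * (F u - F 1)"
proof (rule fps_ext)
  fix n
  show "(fps_const (u - 1) * F u) $ n = (fps_X * fps_const (u^2 * (u - 1))
           + fps_X * fps_const u * F u * (F u - F 1)) $ n"
  proof (cases n)
    case (Suc m)
    have *: "(fps_X * fps_const u * F u * (F u - F 1)) $ n
      = u * (\<Sum>i\<le>m. cut_weight i u * (cut_weight (m - i) u - cut_weight (m - i) 1))"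
      by (simp only: mult.assoc Suc fps_X_mult_nth fps_mult_left_const_nth)
         (simp add: F_def fps_mult_nth atMost_atLeast0)
    show ?thesis
    proof (cases "m = 0")
      case True
      then show ?thesis unfolding fps_add_nth * by (simp add: Suc F_def cut_weight_1 fps_X_def mult.commute)
    next
      case False
      then show ?thesis unfolding fps_add_nth * by (simp add: Suc F_def cut_weight_Suc fps_X_def)
    qed
  qed (simp add: F_def)
qed

section \<open>Eliminating the catalytic variable\<close>

text \<open>
  The polynomial \<open>P(x, u) = z u x\<^sup>2 - (z u f + u - 1) x + z u\<^sup>2 (u - 1)\<close> has \<open>G\<close> as its derivative in
  \<open>x\<close>. If \<open>P(x, u) = 0\<close> and \<open>x'\<close> is the derivative of \<open>x\<close> in \<open>u\<close>, the chain rule gives the second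
  hypothesis. So \<open>P\<close> and both its partial derivatives vanish modulo \<open>G\<close>, which forces, up to a factor
  \<open>z u\<^sup>2\<close>, the two congruences
  \<open>z\<^sup>2 u\<^sup>3 (2 u - 1)\<^sup>2 = u - 1\<close> and \<open>u (2 u - 1) z f = (u - 1) (3 - 2 u)\<close>.
  They parametrize \<open>z\<^sup>2\<close> and \<open>z f\<close> rationally by \<open>u\<close>, and \<open>z RR(f, z)\<close> is a polynomial in these two
  quantities that vanishes on the parametrized curve. The other factors in the conclusion clear the
  denominators.
\<close>

lemma kernel_elimination:
  fixes z u f x x' G :: "'a::idom"
  assumes quadratic: "z * u * x^2 - (z * u * f + u - 1) * x + z * u^2 * (u - 1) = 0"
    and derivative: "z * x^2 - (z * f + 1) * x + z * (3 * u^2 - 2 * u) = - (G * x')"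
    and G: "G = 2 * z * u * x - (z * u * f + u - 1)"
  shows "G dvd z * u^2 * (u * (u * (2 * u - 1))^5) * (z * RR f z)"
proof -
  have x_sq: "z * u * (x^2 - u * (u - 1)) = G * x"
    unfolding G using quadratic by algebra
  have x_eq: "x = z * u^2 * (2 * u - 1) + u * (G * x')"
    using quadratic derivative G by algebra
  define W where "W = z^2 * u^3 * (2 * u - 1)^2"
  define A where "A = u * (2 * u - 1) * (z * f)"
  define q where "q = u * (2 * u - 1)"
  define m where "m = (u - 1) * (3 - 2 * u)"
  have W: "G dvd z * u^2 * (W - (u - 1))"
  proof -
    have "z * u^2 * (W - (u - 1)) = G * x + z * u * (z * u^2 * (2 * u - 1) + x) * (z * u^2 * (2 * u - 1) - x)"
      using x_sq unfolding W_def by algebra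
    also have "z * u^2 * (2 * u - 1) - x = - (u * (G * x'))" using x_eq by algebra
    finally have "z * u^2 * (W - (u - 1)) = G * (x - z * u * (z * u^2 * (2 * u - 1) + x) * (u * x'))"
      by algebra
    then show ?thesis by (rule dvdI)
  qed
  have A: "G dvd z * u^2 * (A - m)"
  proof -
    have "A - m = 2 * (W - (u - 1)) + (2 * u - 1) * (2 * z * u * (u * (G * x')) - G)"
    proof -
      have "z * u * f = 2 * z * u * x - (u - 1) - G" using G by algebra
      then show ?thesis unfolding A_def m_def W_def using x_eq by algebra
    qed
    then have "z * u^2 * (A - m) = 2 * (z * u^2 * (W - (u - 1)))
                 + G * (z * u^2 * (2 * u - 1) * (2 * z * u * (u * x') - 1))"
      by algebra
    then show ?thesis using W by (simp add: dvd_add dvd_mult)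
  qed
  \<comment> \<open>\<open>k\<close> is the divided difference for the replacement of \<open>A\<close> by \<open>m\<close>, and \<open>l\<close> the one for the
    subsequent replacement of \<open>W\<close> by \<open>u - 1\<close>; the polynomial vanishes after both.\<close>
  define k where "k = u * ((q + A)^4 + m * ((q + A)^3 + (q + A)^2 * (q + m) + (q + A) * (q + m)^2 + (q + m)^3))
      + W * ((A^2 + A * m + m^2) + 33 * q * (A + m) - 33 * q^2)"
  define l where "l = (m^3 + 33 * m^2 * q - 33 * m * q^2 - q^3) + 27 * (2 * u - 1) * (W + u - 1)"
  have "u * q^5 * (z * RR f z) = u * A * (q + A)^4 + W * (A^3 + 33 * A^2 * q - 33 * A * q^2 - q^3)
           + 27 * W^2 * (2 * u - 1)"
    unfolding RR_def A_def W_def q_def by algebra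
  also have "\<dots> = (A - m) * k + (W - (u - 1)) * l"
    unfolding k_def l_def q_def m_def by algebra
  finally have "z * u^2 * (u * q^5) * (z * RR f z) = z * u^2 * (A - m) * k + z * u^2 * (W - (u - 1)) * l"
    by algebra
  then show ?thesis
    using W A unfolding q_def by (simp add: dvd_add dvd_mult2)
qed

text \<open>
  Compare the coefficients of lowest order: on the left, the one of \<open>G\<close> makes the product vanish at
  \<open>a\<close>; on the right, the one of a nonzero \<open>R\<close> would be a nonzero constant. This replaces the
  substitution of a power series root of \<open>G\<close> for the polynomial variable.
\<close>

lemma const_multiple_vanishes:
  fixes G H c R :: "int poly fps"
  assumes eq: "G * H = c * R" and G: "G \<noteq> 0" "poly (G $ subdegree G) a = 0"
    and c: "poly (c $ subdegree c) a \<noteq> 0"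
    and R: "\<And>n. \<exists>k. R $ n = [:k:]"
  shows "R = 0"
proof (rule ccontr)
  assume "R \<noteq> 0"
  have "c \<noteq> 0" using c by auto
  with \<open>R \<noteq> 0\<close> eq have "H \<noteq> 0" by auto
  have "subdegree G + subdegree H = subdegree c + subdegree R"
    using eq \<open>R \<noteq> 0\<close> \<open>c \<noteq> 0\<close> \<open>H \<noteq> 0\<close> G by (metis subdegree_mult)
  then have "G $ subdegree G * H $ subdegree H = c $ subdegree c * R $ subdegree R"
    using eq by (metis nth_subdegree_mult)
  then have "poly (c $ subdegree c * R $ subdegree R) a = 0"
    using G(2) by (metis mult_zero_left poly_mult)
  moreover obtain k where "R $ subdegree R = [:k:]" using R by blast
  moreover have "R $ subdegree R \<noteq> 0" using \<open>R \<noteq> 0\<close> by simp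
  ultimately show False using c by auto
qed

definition fps_pderiv :: "'a::idom poly fps \<Rightarrow> 'a poly fps" where
  "fps_pderiv F = Abs_fps (\<lambda>n. pderiv (F $ n))"

lemma fps_pderiv_add: "fps_pderiv (F + G) = fps_pderiv F + fps_pderiv G"
  by (simp add: fps_pderiv_def fps_eq_iff pderiv_add)

lemma fps_pderiv_diff: "fps_pderiv (F - G) = fps_pderiv F - fps_pderiv G"
  by (simp add: fps_pderiv_def fps_eq_iff pderiv_diff)

lemma fps_pderiv_mult: "fps_pderiv (F * G) = F * fps_pderiv G + fps_pderiv F * G"
  by (simp add: higher_pderiv_sum [where n = 1, simplified] fps_pderiv_def fps_eq_iff fps_mult_nth pderiv_mult sum.distrib)
     (simp add: mult.commute)

lemma fps_pderiv_const: "fps_pderiv (fps_const p) = fps_const (pderiv p)"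
  by (simp add: fps_pderiv_def fps_eq_iff)

lemma fps_pderiv_X: "fps_pderiv fps_X = 0"
  by (simp add: fps_pderiv_def fps_eq_iff fps_X_def pderiv_1)

text \<open>
  For polynomial coefficients this embeds the series that do not involve the polynomial variable.
\<close>

definition fps_lift :: "int fps \<Rightarrow> 'a::comm_ring_1 fps" where
  "fps_lift h = Abs_fps (\<lambda>n. of_int (h $ n))"

lemma fps_lift_nth [simp]: "fps_lift h $ n = of_int (h $ n)"
  by (simp add: fps_lift_def)

lemma fps_lift_mult: "fps_lift (g * h) = fps_lift g * fps_lift h"
  by (simp add: fps_eq_iff fps_mult_nth)

lemma fps_lift_add: "fps_lift (g + h) = fps_lift g + fps_lift h"
  and fps_lift_diff: "fps_lift (g - h) = fps_lift g - fps_lift h"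
  and fps_lift_uminus: "fps_lift (- g) = - fps_lift g"
  and fps_lift_1: "fps_lift 1 = 1"
  and fps_lift_X: "fps_lift fps_X = fps_X"
  by (simp_all add: fps_eq_iff fps_X_def)

lemma fps_lift_power: "fps_lift (g ^ k) = fps_lift g ^ k"
  by (induction k) (simp_all add: fps_lift_1 fps_lift_mult)

lemma fps_lift_numeral: "fps_lift (numeral k) = numeral k"
  by (simp add: fps_eq_iff fps_numeral_nth)

lemma fps_lift_RR: "fps_lift (RR g h) = RR (fps_lift g) (fps_lift h)"
  by (simp add: RR_def fps_lift_add fps_lift_diff fps_lift_uminus fps_lift_mult fps_lift_power
      fps_lift_1 fps_lift_numeral)

text \<open>
  The series live over the polynomials in \<open>u\<close>. Written as a quadratic equation for \<open>F\<close>, the hypothesis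
  and its derivative in \<open>u\<close> make \<open>G\<close> divide a multiple of \<open>RR(f, z)\<close>. The constant term of \<open>G\<close> in
  \<open>z\<close> is \<open>1 - u\<close>, which vanishes at \<open>u = 1\<close>, whereas the extra factor is \<open>z\<^sup>2\<close> times a polynomial in
  \<open>u\<close> with the value 1 there.
\<close>

lemma functional_equation_imp_RR:
  fixes F :: "int poly fps" and f :: "int fps"
  assumes feq: "fps_const [:-1, 1:] * F = fps_X * fps_const ([:0, 1:]^2 * [:-1, 1:])
                 + fps_X * fps_const [:0, 1:] * F * (F - fps_lift f)"
  shows "RR f fps_X = 0"
proof -
  define u :: "int poly fps" where "u = fps_const [:0, 1:]"
  define z :: "int poly fps" where "z = fps_X"
  define g :: "int poly fps" where "g = fps_lift f"
  define G where "G = 2 * z * u * F - (z * u * g + u - 1)"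
  have u1: "fps_const [:-1, 1:] = u - 1"
    by (simp add: u_def fps_eq_iff one_pCons)
  have D: "fps_pderiv u = 1" "fps_pderiv z = 0" "fps_pderiv g = 0" "fps_pderiv 1 = (0 :: int poly fps)"
    by (simp_all add: u_def z_def g_def fps_pderiv_const fps_pderiv_X pderiv_pCons)
       (simp_all add: fps_eq_iff fps_pderiv_def of_int_poly pderiv_pCons)
  have feq': "(u - 1) * F = z * (u * u * (u - 1)) + z * u * F * (F - g)"
    using feq unfolding fps_const_mult [symmetric] u1 power2_eq_square
    by (simp add: u_def z_def g_def fps_const_mult [symmetric] u1 del: fps_const_mult)
  have quad: "z * u * F^2 - (z * u * g + u - 1) * F + z * u^2 * (u - 1) = 0"
    using feq' by algebra
  have "fps_pderiv ((u - 1) * F) = fps_pderiv (z * (u * u * (u - 1)) + z * u * F * (F - g))"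
    using feq' by simp
  then have der: "z * F^2 - (z * g + 1) * F + z * (3 * u^2 - 2 * u) = - (G * fps_pderiv F)"
    unfolding G_def fps_pderiv_mult fps_pderiv_add fps_pderiv_diff D by algebra
  obtain H where "z * u^2 * (u * (u * (2 * u - 1))^5) * (z * RR g z) = G * H"
    using kernel_elimination [OF quad der G_def] by (rule dvdE)
  then have H: "G * H = z * u^2 * (u * (u * (2 * u - 1))^5) * z * RR g z"
    by (simp only: mult.assoc)
  define p :: "int poly" where "p = [:0,1:]^3 * ([:0,1:] * [:-1, 2:])^5"
  have c: "z * u^2 * (u * (u * (2 * u - 1))^5) * z = fps_const p * fps_X ^ 2"
  proof -
    have "fps_const [:-1, 2:] = 2 * u - 1"
      by (simp add: u_def fps_eq_iff one_pCons fps_numeral_nth numeral_poly)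
    then have p: "fps_const p = u^3 * (u * (2 * u - 1))^5"
      unfolding p_def fps_const_mult [symmetric] fps_const_power [symmetric]
      by (simp only: u_def [symmetric])
    show ?thesis
      unfolding p z_def [symmetric] by (simp only: power2_eq_square power3_eq_cube mult_ac)
  qed
  have p1: "poly p 1 \<noteq> 0" by (simp add: p_def)
  then have "p \<noteq> 0" by auto
  then have cX: "subdegree (fps_const p * fps_X ^ 2) = 2" "(fps_const p * fps_X ^ 2) $ 2 = p"
    by (simp_all add: fps_X_power_mult_right_nth)
  have G0: "G $ 0 = [:1, -1:]"
    by (simp add: G_def z_def u_def one_pCons)
  then have sG: "G \<noteq> 0" "subdegree G = 0" by (auto simp: subdegree_eq_0_iff)
  have "RR g z = fps_lift (RR f fps_X)"
    by (simp add: fps_lift_RR g_def z_def fps_lift_X)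
  moreover have "RR g z = 0"
  proof (rule const_multiple_vanishes [where a = 1])
    show "G * H = (fps_const p * fps_X ^ 2) * RR g z" using H unfolding c by simp
    show "\<exists>k. RR g z $ n = [:k:]" for n
      unfolding \<open>RR g z = _\<close> by (auto simp: of_int_poly)
  qed (simp_all add: sG G0 cX p1 del: power_mult_distrib)
  ultimately show ?thesis by (simp add: fps_eq_iff)
qed

lemma tree_gf_nth: "tree_gf $ n = int (card (trees_on {1..n}))"
proof -
  have "postorder -` Av231 n \<inter> DFBPT = trees_on {1..n}"
  proof (intro equalityI subsetI)
    fix t assume "t \<in> postorder -` Av231 n \<inter> DFBPT"
    then show "t \<in> trees_on {1..n}"
      by (simp add: Av231_eq DFBPT_def trees_on_def in_perms_iff)
  next
    fix t assume t: "t \<in> trees_on {1..n}"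
    then have "size t = n" using size_trees_on by fastforce
    with t show "t \<in> postorder -` Av231 n \<inter> DFBPT"
      by (simp add: Av231_eq DFBPT_def trees_on_def in_perms_iff)
  qed
  then show ?thesis by (simp add: tree_gf_def)
qed

lemma RR_tree_gf: "RR tree_gf fps_X = 0"
proof (rule functional_equation_imp_RR)
  define F :: "int poly \<Rightarrow> int poly fps" where "F = (\<lambda>v. Abs_fps (\<lambda>n. cut_weight n v))"
  have "fps_lift tree_gf = F 1"
    by (simp add: fps_eq_iff tree_gf_nth F_def cut_weight_def)
  then show "fps_const [:-1, 1:] * F [:0, 1:] = fps_X * fps_const ([:0, 1:]^2 * [:-1, 1:])
       + fps_X * fps_const [:0, 1:] * F [:0, 1:] * (F [:0, 1:] - fps_lift tree_gf)"
    using cut_gf_equation [of "[:0, 1:] :: int poly"] by (simp add: F_def one_pCons)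
qed

section \<open>In-order readings and stack-sorting\<close>

definition alternating :: "'a::linorder list \<Rightarrow> bool" where
  "alternating w \<longleftrightarrow> odd (length w) \<and> (\<forall>i\<in>{1..<length w}. w ! i < w ! (i - 1) \<longleftrightarrow> even i)"

text \<open>
  The maximum is a peak unless it is the only entry: positions counted from 0, it sits at an odd index,
  neither first nor last. So both neighbouring parts are nonempty of odd length, and the part to the right
  starts at an even index, which preserves the parity of its descents.
\<close>

lemma alternating_around_max:
  assumes max: "\<forall>x\<in>set L \<union> set R. x < a"
  shows "alternating (L @ a # R) \<longleftrightarrow> (L = [] \<and> R = []) \<or> (alternating L \<and> alternating R)"
proof -
  define w where "w = L @ a # R"
  define p where "p = length L"
  define q where "q = length R"
  have wL: "w ! i = L ! i" if "i < p" for i using that by (simp add: w_def p_def nth_append)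
  have wp: "w ! p = a" by (simp add: w_def p_def)
  have wR: "w ! (Suc p + j) = R ! j" for j by (simp add: w_def p_def nth_append)
  have len: "length w = Suc (p + q)" by (simp add: w_def p_def q_def)
  have L: "L ! i < a" if "i < p" for i using that max by (simp add: p_def)
  have R: "R ! j < a" if "j < q" for j using that max by (simp add: q_def)
  have inL: "w ! i < w ! (i - 1) \<longleftrightarrow> L ! i < L ! (i - 1)" if "i < p" for i
    using that wL [of i] wL [of "i - 1"] by simp
  have inR: "w ! (Suc p + j) < w ! (Suc p + j - 1) \<longleftrightarrow> R ! j < R ! (j - 1)" if "1 \<le> j" for j
    using that wR [of j] wR [of "j - 1"] by (cases j) simp_all
  show ?thesis unfolding w_def [symmetric]
  proof
    assume w: "alternating w"
    then have alt: "w ! i < w ! (i - 1) \<longleftrightarrow> even i" if "1 \<le> i" "i < Suc (p + q)" for i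
      using that len by (simp add: alternating_def)
    show "(L = [] \<and> R = []) \<or> (alternating L \<and> alternating R)"
    proof (cases "p = 0 \<and> q = 0")
      case False
      have "odd p"
      proof
        assume "even p"
        show False
        proof (cases "p = 0")
          case True
          then have "w ! 1 < w ! 0" using wR [of 0] wp R [of 0] False by simp
          then show False using alt [of 1] True False by simp
        next
          case p: False
          then have "a < L ! (p - 1)" using alt [of p] \<open>even p\<close> wp wL [of "p - 1"] by simp
          then show False using L [of "p - 1"] p by simp
        qed
      qed
      moreover have "odd (Suc (p + q))" using w len by (simp add: alternating_def)
      ultimately have pq: "odd p" "odd q" by auto
      have "L ! i < L ! (i - 1) \<longleftrightarrow> even i" if "1 \<le> i" "i < p" for i
        using alt [of i] inL [of i] that by simp
      then have "alternating L" using pq by (simp add: alternating_def p_def)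
      moreover have "R ! j < R ! (j - 1) \<longleftrightarrow> even j" if "1 \<le> j" "j < q" for j
      proof -
        have "w ! (Suc p + j) < w ! (Suc p + j - 1) \<longleftrightarrow> even (Suc p + j)"
          using that by (intro alt) auto
        then show ?thesis using inR [OF that(1)] pq by simp
      qed
      then have "alternating R" using pq by (simp add: alternating_def q_def)
      ultimately show ?thesis by simp
    qed (simp add: p_def q_def)
  next
    assume "(L = [] \<and> R = []) \<or> (alternating L \<and> alternating R)"
    then show "alternating w"
    proof
      assume "L = [] \<and> R = []"
      then show ?thesis by (simp add: w_def alternating_def)
    next
      assume LR: "alternating L \<and> alternating R"
      then have pq: "odd p" "odd q" by (simp_all add: alternating_def p_def q_def)
      have "w ! i < w ! (i - 1) \<longleftrightarrow> even i" if i: "1 \<le> i" "i < Suc (p + q)" for i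
      proof -
        consider "i < p" | "i = p" | "i = Suc p" | "Suc p < i" by linarith
        then show ?thesis
        proof cases
          case 1
          then show ?thesis using inL [of i] LR i by (simp add: alternating_def p_def)
        next
          case 2
          then show ?thesis using wp wL [of "p - 1"] L [of "p - 1"] pq i by auto
        next
          case 3
          then show ?thesis using wp wR [of 0] R [of 0] pq i by auto
        next
          case 4
          define j where "j = i - Suc p"
          have j: "i = Suc p + j" "1 \<le> j" "j < q" using 4 i by (simp_all add: j_def)
          then have "R ! j < R ! (j - 1) \<longleftrightarrow> even j" using LR by (simp add: alternating_def q_def)
          then show ?thesis using inR [OF j(2)] pq unfolding j(1) by simp
        qed
      qed
      then show ?thesis using pq len by (simp add: alternating_def)
    qed
  qed
qed

lemma full_tree_iff_alternating:
  "decreasing_tree t \<Longrightarrow> full_tree t \<longleftrightarrow> alternating (inorder t)"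
proof (induction t)
  case Leaf
  then show ?case by (simp add: alternating_def)
next
  case (Node l a r)
  have "\<forall>x\<in>set (inorder l) \<union> set (inorder r). x < a"
    using Node.prems by (simp add: decreasing_tree_Node)
  then have "alternating (inorder (Node l a r)) \<longleftrightarrow>
      (inorder l = [] \<and> inorder r = []) \<or> (alternating (inorder l) \<and> alternating (inorder r))"
    using alternating_around_max [of "inorder l" "inorder r" a] by simp
  moreover have "inorder t = [] \<longleftrightarrow> t = Leaf" for t :: "nat tree" by (cases t) auto
  ultimately show ?case using Node by (simp add: full_tree_Node decreasing_tree_Node)
qed

lemma ex_decreasing_tree:
  "distinct w \<Longrightarrow> \<exists>t. decreasing_tree t \<and> inorder t = w"
proof (induction "length w" arbitrary: w rule: less_induct)
  case less
  show ?case
  proof (cases "w = []")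
    case True
    then show ?thesis by (intro exI [of _ Leaf]) simp
  next
    case False
    then have "Max (set w) \<in> set w" by simp
    then obtain L R where w: "w = L @ Max (set w) # R" by (metis split_list)
    define a where "a = Max (set w)"
    have w: "w = L @ a # R" using w by (simp add: a_def)
    have d: "distinct L" "distinct R" "a \<notin> set L \<union> set R"
      using less.prems unfolding w by simp_all
    have "x < a" if "x \<in> set L \<union> set R" for x
    proof -
      have "x \<le> a" unfolding a_def by (rule Max_ge) (use that in \<open>simp_all add: w\<close>)
      moreover have "x \<noteq> a" using that d(3) by blast
      ultimately show ?thesis by simp
    qed
    moreover obtain l where "decreasing_tree l" "inorder l = L"
      using less.hyps [of L] d(1) unfolding w by auto
    moreover obtain r where "decreasing_tree r" "inorder r = R"
      using less.hyps [of R] d(2) unfolding w by auto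
    ultimately show ?thesis
      unfolding w by (intro exI [of _ "Node l a r"]) (auto simp: decreasing_tree_Node)
  qed
qed

lemma inorder_inject:
  assumes "decreasing_tree s" "decreasing_tree t" "inorder s = inorder t"
  shows "s = t"
  using assms
proof (induction s arbitrary: t)
  case Leaf
  then show ?case by (cases t) auto
next
  case (Node l a r)
  from Node.prems(3) obtain l' a' r' where t: "t = Node l' a' r'" by (cases t) auto
  have eq: "inorder l @ a # inorder r = inorder l' @ a' # inorder r'"
    using Node.prems(3) by (simp add: t)
  have lt: "\<forall>x\<in>set (inorder l) \<union> set (inorder r). x < a"
    "\<forall>x\<in>set (inorder l') \<union> set (inorder r'). x < a'"
    using Node.prems by (simp_all add: t decreasing_tree_Node)
  have "a \<in> set (inorder l' @ a' # inorder r')" "a' \<in> set (inorder l @ a # inorder r)"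
    unfolding eq [symmetric] by simp (simp add: eq)
  then have "a = a'" using lt by (metis Un_iff less_asym set_ConsD set_append)
  moreover have "a \<notin> set (inorder l)" "a \<notin> set (inorder r)" using lt by auto
  ultimately have "inorder l = inorder l'" "inorder r = inorder r'"
    using eq append_Cons_eq_iff by metis+
  then show ?case
    using Node.IH Node.prems \<open>a = a'\<close> by (simp add: t decreasing_tree_Node)
qed

lemma stack_sort_inorder: "decreasing_tree t \<Longrightarrow> stack_sort (inorder t) = postorder t"
  by (induction t) (simp_all add: decreasing_tree_Node stack_sort_LmR)

text \<open>
  For a single stack, sortable means 231-avoiding: with \<open>a\<close> the largest entry, both conditions say that the
  two sides of \<open>a\<close> satisfy them and that everything on the left is smaller than everything on the right.
\<close>

lemma sorted_postorder_iff:
  "decreasing_tree t \<Longrightarrow> distinct (inorder t) \<Longrightarrow>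
    sorted_wrt (<) (postorder t) \<longleftrightarrow> avoids_231 (inorder t)"
proof (induction t)
  case (Node l a r)
  let ?L = "inorder l" and ?R = "inorder r"
  have lt: "x < a" if "x \<in> set ?L \<union> set ?R" for x
    using that Node.prems by (auto simp: decreasing_tree_Node)
  have disj: "set ?L \<inter> set ?R = {}" using Node.prems by auto
  have IH: "sorted_wrt (<) (postorder l) \<longleftrightarrow> avoids_231 ?L" "sorted_wrt (<) (postorder r) \<longleftrightarrow> avoids_231 ?R"
    using Node by (auto simp: decreasing_tree_Node)
  have "avoids_231 (?L @ a # ?R) \<longleftrightarrow> avoids_231 ?L \<and> avoids_231 ?R \<and> (\<forall>x\<in>set ?L. \<forall>z\<in>set ?R. x < z)"
  proof
    assume av: "avoids_231 (?L @ a # ?R)"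
    have "x < z" if "x \<in> set ?L" "z \<in> set ?R" for x z
    proof -
      have "splits x (a # ?R)" using av that(1) by (simp add: avoids_231_append del: set_inorder)
      then have "\<not> (z < x \<and> x < a)" using that(2) unfolding splits_Cons by blast
      moreover have "x < a" using lt that by blast
      moreover have "x \<noteq> z" using that disj by blast
      ultimately show ?thesis by (meson linorder_neqE)
    qed
    then show "avoids_231 ?L \<and> avoids_231 ?R \<and> (\<forall>x\<in>set ?L. \<forall>z\<in>set ?R. x < z)"
      using av by (simp add: avoids_231_append)
  next
    assume *: "avoids_231 ?L \<and> avoids_231 ?R \<and> (\<forall>x\<in>set ?L. \<forall>z\<in>set ?R. x < z)"
    have ge: "x \<le> z" if "x \<in> set ?L" "z \<in> set (a # ?R)" for x z
      using * that lt by (cases "z = a") (auto intro: less_imp_le)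
    have "splits a ?R" using lt by (intro splits_if_le less_imp_le) blast
    moreover have "\<forall>x\<in>set ?L. splits x (a # ?R)" using ge splits_if_ge by blast
    moreover have "sorted_wrt (\<lambda>x y. \<forall>z\<in>set (a # ?R). \<not> (z < x \<and> x < y)) xs" if "set xs \<subseteq> set ?L" for xs
      using that by (induction xs) (use ge in \<open>auto simp: not_less\<close>)
    ultimately show "avoids_231 (?L @ a # ?R)"
      using * unfolding avoids_231_append avoids_231.simps(2) by blast
  qed
  moreover have "sorted_wrt (<) (postorder (Node l a r)) \<longleftrightarrow>
     sorted_wrt (<) (postorder l) \<and> sorted_wrt (<) (postorder r) \<and> (\<forall>x\<in>set ?L. \<forall>z\<in>set ?R. x < z)"
    using lt by (auto simp: sorted_wrt_append)
  ultimately show ?case using IH by simp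
qed simp

lemma distinct_inorder_iff: "distinct (inorder t) \<longleftrightarrow> distinct (postorder t)"
  by (metis card_distinct distinct_card length_inorder length_postorder set_inorder set_postorder)

lemma in_ALT_iff:
  assumes "w \<in> perms n" "odd n"
  shows "w \<in> ALT \<longleftrightarrow> alternating w"
proof -
  have len: "length w = n'" if "w \<in> perms n'" for n'
    using that by (auto simp: in_perms_iff dest: distinct_card)
  have "w \<in> ALT \<longleftrightarrow> descents w = {i \<in> {1..<n}. even i}"
    using len assms(1) by (auto simp: ALT_def)
  also have "\<dots> \<longleftrightarrow> (\<forall>i\<in>{1..<n}. w ! i < w ! (i - 1) \<longleftrightarrow> even i)"
    unfolding descents_def len [OF assms(1)] by blast
  also have "\<dots> \<longleftrightarrow> alternating w"
    using assms(2) len [OF assms(1)] by (simp add: alternating_def)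
  finally show ?thesis .
qed

text \<open>
  Stack-sorting turns the in-order reading of a decreasing tree into its postorder reading. Hence the
  in-order reading is 2-stack-sortable exactly if the postorder reading is sortable by a single pass,
  that is, avoids 231.
\<close>

lemma bij_betw_inorder:
  assumes "odd n"
  shows "bij_betw inorder (trees_on {1..n}) (W2 n \<inter> ALT)"
proof -
  have inW: "inorder t \<in> W2 n \<inter> ALT \<longleftrightarrow> t \<in> trees_on {1..n}" if t: "decreasing_tree t" for t
  proof -
    have "inorder t \<in> W2 n \<inter> ALT \<longleftrightarrow> inorder t \<in> perms n \<and> full_tree t \<and>
        sorted_wrt (<) (stack_sort (postorder t))"
      using in_ALT_iff [OF _ assms] full_tree_iff_alternating [OF t]
      by (auto simp: W2_def stack_sort_inorder [OF t])
    also have "\<dots> \<longleftrightarrow> t \<in> trees_on {1..n}"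
    proof (cases "distinct (postorder t)")
      case True
      then obtain s where s: "decreasing_tree s" "inorder s = postorder t"
        using ex_decreasing_tree by blast
      then have "sorted_wrt (<) (stack_sort (postorder t)) \<longleftrightarrow> avoids_231 (postorder t)"
        using sorted_postorder_iff [OF s(1)] stack_sort_inorder [OF s(1)] True by simp
      then show ?thesis using t True by (auto simp: trees_on_def in_perms_iff distinct_inorder_iff)
    qed (auto simp: trees_on_def in_perms_iff distinct_inorder_iff)
    finally show ?thesis .
  qed
  have dec: "decreasing_tree t" if "t \<in> trees_on {1..n}" for t
    using that by (simp add: trees_on_def)
  show ?thesis
  proof (rule bij_betwI')
    show "inorder s = inorder t \<longleftrightarrow> s = t" if "s \<in> trees_on {1..n}" "t \<in> trees_on {1..n}" for s t
      using that dec inorder_inject by blast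
    show "inorder t \<in> W2 n \<inter> ALT" if "t \<in> trees_on {1..n}" for t
      using that dec inW by blast
    show "\<exists>t\<in>trees_on {1..n}. w = inorder t" if "w \<in> W2 n \<inter> ALT" for w
    proof -
      have "distinct w" using that by (auto simp: W2_def in_perms_iff)
      then obtain t where "decreasing_tree t" "inorder t = w" using ex_decreasing_tree by blast
      then show ?thesis using inW that by blast
    qed
  qed
qed

lemma trees_on_even: "even n \<Longrightarrow> trees_on {1..n} = {}"
proof -
  have "odd n" if "t \<in> trees_on {1..n}" for t
  proof -
    have "alternating (inorder t)"
      using that full_tree_iff_alternating by (auto simp: trees_on_def)
    then show ?thesis using size_trees_on [OF that] by (simp add: alternating_def)
  qed
  then show "even n \<Longrightarrow> trees_on {1..n} = {}" by blast
qed

lemma tree_gf_eq_alt_gf: "tree_gf = alt_gf"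
proof (rule fps_ext)
  fix n
  show "tree_gf $ n = alt_gf $ n"
    using bij_betw_same_card [OF bij_betw_inorder, of n] trees_on_even [of n]
    by (cases "odd n") (simp_all only: tree_gf_nth alt_gf_def fps_nth_Abs_fps if_True if_False, simp_all)
qed

section \<open>The generating function\<close>

theorem corollary9p3:
  shows "tree_gf = alt_gf \<and> RR tree_gf fps_X = 0"
  using tree_gf_eq_alt_gf RR_tree_gf by (rule conjI)

end
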